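(* Let $3<p<\infty$ and $\frac1p+\frac1q=1$. Let $F:l_p\times l_p\to l_q$ be defined by $F(x,y)=J(x)+\mathfrak J(y)$ for $x,y\in l_p$. Then (i) $\partial_1^C(F)=\emptyset$ and $E_1(F)=\emptyset$; (ii) $\partial_2^C(F)=l_p\times\{\theta\}$ and $E_2(F)=\emptyset$.
   Context: $l_p,l_q$ are real sequence spaces with null element $\theta=(0,0,\dots)$; $l_q$ is partially ordered by its positive cone $M=\{\{t_n\}\in l_q:t_n\ge0\ \forall n\}$, i.e. $z_1\preccurlyeq_Mz_2$ iff $z_2-z_1\in M$. The normalized duality mapping $J:l_p\to l_q$: $J(\theta)=\theta$ and $J(x)=\left\{\frac{|t_n|^{p-1}\operatorname{sign}(t_n)}{\|x\|_p^{p-2}}\right\}_{n=1}^\infty$ for $x=\{t_n\}\ne\theta$. The generalized duality mapping $\mathfrak J:l_p\to l_q$: $\mathfrak J(y)=\left\{\frac{|s_n|^{p-1}\operatorname{sign}(s_n)}{1+|s_n|}\right\}_{n=1}^\infty$ for $y=\{s_n\}\in l_p$. Partial Gâteaux derivatives (limits in $l_q$ over real $t$, required to exist for every $v\in l_p\setminus\{\theta\}$): $\partial_1F(\bar x,\bar y)(v)=\lim_{t\to0}\frac{F(\bar x+tv,\bar y)-F(\bar x,\bar y)}{t}$ and $\partial_2F(\bar x,\bar y)(v)=\lim_{t\to0}\frac{F(\bar x,\bar y+tv)-F(\bar x,\bar y)}{t}$. For $i=1,2$, $\partial_i^C(F)$ is the set of points $(\bar x,\bar y)\in l_p\times l_p$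 at which $\partial_iF(\bar x,\bar y)(v)$ exists and equals $\theta$ for every $v\in l_p\setminus\{\theta\}$. $E_1(F)$ is the set of $(\bar x,\bar y)\in l_p\times l_p$ such that either $F(\bar x,\bar y)\preccurlyeq_MF(x,\bar y)$ for all $x\in l_p$, or $F(x,\bar y)\preccurlyeq_MF(\bar x,\bar y)$ for all $x\in l_p$. $E_2(F)$ is the set of $(\bar x,\bar y)$ such that either $F(\bar x,\bar y)\preccurlyeq_MF(\bar x,y)$ for all $y\in l_p$, or $F(\bar x,y)\preccurlyeq_MF(\bar x,\bar y)$ for all $y\in l_p$. *)

theory Defs
  imports "HOL-Analysis.Analysis"
begin

text \<open>Real sequences are functions on \<^typ>\<open>nat\<close>, so the index starts at 0 instead of 1.\<close>

definition lp :: "real \<Rightarrow> (nat \<Rightarrow> real) set" where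
  "lp p = {x. summable (\<lambda>n. \<bar>x n\<bar> powr p)}"

definition lp_norm :: "real \<Rightarrow> (nat \<Rightarrow> real) \<Rightarrow> real" where
  "lp_norm p x = (\<Sum>n. \<bar>x n\<bar> powr p) powr (1 / p)"

definition theta_seq :: "nat \<Rightarrow> real" ("\<theta>") where
  "\<theta> = (\<lambda>n. 0)"

definition pos_cone :: "real \<Rightarrow> (nat \<Rightarrow> real) set" where
  "pos_cone q = {z \<in> lp q. \<forall>n. z n \<ge> 0}"

definition cone_le :: "real \<Rightarrow> (nat \<Rightarrow> real) \<Rightarrow> (nat \<Rightarrow> real) \<Rightarrow> bool" where
  "cone_le q z1 z2 \<longleftrightarrow> (\<lambda>n. z2 n - z1 n) \<in> pos_cone q"

definition duality_map :: "real \<Rightarrow> (nat \<Rightarrow> real) \<Rightarrow> nat \<Rightarrow> real" where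
  "duality_map p x =
     (if x = \<theta> then \<theta>
      else (\<lambda>n. \<bar>x n\<bar> powr (p - 1) * sgn (x n) / lp_norm p x powr (p - 2)))"

definition gen_duality_map :: "real \<Rightarrow> (nat \<Rightarrow> real) \<Rightarrow> nat \<Rightarrow> real" where
  "gen_duality_map p y = (\<lambda>n. \<bar>y n\<bar> powr (p - 1) * sgn (y n) / (1 + \<bar>y n\<bar>))"

definition tendsto_lp :: "real \<Rightarrow> ('a \<Rightarrow> nat \<Rightarrow> real) \<Rightarrow> (nat \<Rightarrow> real) \<Rightarrow> 'a filter \<Rightarrow> bool" where
  "tendsto_lp q G z \<F> \<longleftrightarrow>
     z \<in> lp q \<and> eventually (\<lambda>t. G t \<in> lp q) \<F> \<and>
     ((\<lambda>t. lp_norm q (\<lambda>n. G t n - z n)) \<longlongrightarrow> 0) \<F>"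

text \<open>Partial Gateaux derivatives in \<^term>\<open>lp q\<close>, as relations: the derivative at \<^term>\<open>(x, y)\<close>
  in direction \<^term>\<open>v\<close> exists and equals \<^term>\<open>w\<close>.\<close>

definition has_partial1 ::
  "real \<Rightarrow> ((nat \<Rightarrow> real) \<times> (nat \<Rightarrow> real) \<Rightarrow> nat \<Rightarrow> real) \<Rightarrow>
   (nat \<Rightarrow> real) \<Rightarrow> (nat \<Rightarrow> real) \<Rightarrow> (nat \<Rightarrow> real) \<Rightarrow> (nat \<Rightarrow> real) \<Rightarrow> bool" where
  "has_partial1 q F x y v w \<longleftrightarrow>
     tendsto_lp q (\<lambda>t n. (F (\<lambda>k. x k + t * v k, y) n - F (x, y) n) / t) w (at 0)"

definition has_partial2 ::
  "real \<Rightarrow> ((nat \<Rightarrow> real) \<times> (nat \<Rightarrow> real) \<Rightarrow> nat \<Rightarrow> real) \<Rightarrow>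
   (nat \<Rightarrow> real) \<Rightarrow> (nat \<Rightarrow> real) \<Rightarrow> (nat \<Rightarrow> real) \<Rightarrow> (nat \<Rightarrow> real) \<Rightarrow> bool" where
  "has_partial2 q F x y v w \<longleftrightarrow>
     tendsto_lp q (\<lambda>t n. (F (x, \<lambda>k. y k + t * v k) n - F (x, y) n) / t) w (at 0)"

definition crit1 ::
  "real \<Rightarrow> real \<Rightarrow> ((nat \<Rightarrow> real) \<times> (nat \<Rightarrow> real) \<Rightarrow> nat \<Rightarrow> real) \<Rightarrow>
   ((nat \<Rightarrow> real) \<times> (nat \<Rightarrow> real)) set" where
  "crit1 p q F = {(x, y) \<in> lp p \<times> lp p. \<forall>v \<in> lp p - {\<theta>}. has_partial1 q F x y v \<theta>}"

definition crit2 ::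
  "real \<Rightarrow> real \<Rightarrow> ((nat \<Rightarrow> real) \<times> (nat \<Rightarrow> real) \<Rightarrow> nat \<Rightarrow> real) \<Rightarrow>
   ((nat \<Rightarrow> real) \<times> (nat \<Rightarrow> real)) set" where
  "crit2 p q F = {(x, y) \<in> lp p \<times> lp p. \<forall>v \<in> lp p - {\<theta>}. has_partial2 q F x y v \<theta>}"

definition extr1 ::
  "real \<Rightarrow> real \<Rightarrow> ((nat \<Rightarrow> real) \<times> (nat \<Rightarrow> real) \<Rightarrow> nat \<Rightarrow> real) \<Rightarrow>
   ((nat \<Rightarrow> real) \<times> (nat \<Rightarrow> real)) set" where
  "extr1 p q F = {(x0, y0) \<in> lp p \<times> lp p.
     (\<forall>x \<in> lp p. cone_le q (F (x0, y0)) (F (x, y0))) \<or>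
     (\<forall>x \<in> lp p. cone_le q (F (x, y0)) (F (x0, y0)))}"

definition extr2 ::
  "real \<Rightarrow> real \<Rightarrow> ((nat \<Rightarrow> real) \<times> (nat \<Rightarrow> real) \<Rightarrow> nat \<Rightarrow> real) \<Rightarrow>
   ((nat \<Rightarrow> real) \<times> (nat \<Rightarrow> real)) set" where
  "extr2 p q F = {(x0, y0) \<in> lp p \<times> lp p.
     (\<forall>y \<in> lp p. cone_le q (F (x0, y0)) (F (x0, y))) \<or>
     (\<forall>y \<in> lp p. cone_le q (F (x0, y)) (F (x0, y0)))}"

text \<open>Since \<^const>\<open>cone_le\<close> and \<^const>\<open>tendsto_lp\<close> fail outside \<^term>\<open>lp q\<close>, the
  definitions above are meaningful only for maps into \<^term>\<open>lp q\<close>; both duality maps, and hence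
  their sum, are such maps.\<close>

lemma conjugate_exponent:
  fixes p q :: real
  assumes "1 < p" and "1 / p + 1 / q = 1"
  shows "0 < q" and "(p - 1) * q = p"
proof -
  have q: "q \<noteq> 0" using assms by auto
  have "q + p = p * q" using assms q by (simp add: field_simps)
  then show e: "(p - 1) * q = p" by (simp add: algebra_simps)
  show "0 < q" using e assms(1) by (metis diff_gt_0_iff_gt less_trans zero_less_mult_pos zero_less_one)
qed

lemma lp_add:
  assumes "0 < q" and "a \<in> lp q" and "b \<in> lp q"
  shows "(\<lambda>n. a n + b n) \<in> lp q"
proof -
  have bd: "\<bar>a n + b n\<bar> powr q \<le> 2 powr q * (\<bar>a n\<bar> powr q + \<bar>b n\<bar> powr q)" for n
  proof -
    have "\<bar>a n + b n\<bar> powr q \<le> (2 * max \<bar>a n\<bar> \<bar>b n\<bar>) powr q"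
      using assms(1) by (intro powr_mono2) auto
    also have "\<dots> = 2 powr q * (max \<bar>a n\<bar> \<bar>b n\<bar>) powr q"
      by (simp add: powr_mult)
    also have "\<dots> \<le> 2 powr q * (\<bar>a n\<bar> powr q + \<bar>b n\<bar> powr q)"
      by (intro mult_left_mono) (auto simp: max_def)
    finally show ?thesis .
  qed
  have "summable (\<lambda>n. 2 powr q * (\<bar>a n\<bar> powr q + \<bar>b n\<bar> powr q))"
    using assms by (auto simp: lp_def intro: summable_mult summable_add)
  then show ?thesis
    unfolding lp_def mem_Collect_eq
    by (rule summable_comparison_test') (use bd in auto)
qed

lemma duality_map_in_lp:
  fixes p q :: real
  assumes "1 < p" and "1 / p + 1 / q = 1" and "x \<in> lp p"
  shows "duality_map p x \<in> lp q"
proof (cases "x = \<theta>")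
  case True
  then show ?thesis by (simp add: duality_map_def lp_def theta_seq_def)
next
  case False
  define c where "c = lp_norm p x powr (p - 2)"
  have "\<bar>duality_map p x n\<bar> powr q = \<bar>x n\<bar> powr p / c powr q" for n
  proof (cases "x n = 0")
    case True
    then show ?thesis using False by (simp add: duality_map_def)
  next
    case nz: False
    have "\<bar>duality_map p x n\<bar> = \<bar>x n\<bar> powr (p - 1) / c"
      using False nz by (simp add: duality_map_def c_def abs_mult abs_sgn_eq)
    then show ?thesis
      using conjugate_exponent[OF assms(1,2)] by (simp add: powr_divide powr_powr)
  qed
  then show ?thesis
    using assms(3) by (simp add: lp_def summable_divide)
qed

lemma gen_duality_map_in_lp:
  fixes p q :: real
  assumes "1 < p" and "1 / p + 1 / q = 1" and "y \<in> lp p"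
  shows "gen_duality_map p y \<in> lp q"
proof -
  have bd: "\<bar>gen_duality_map p y n\<bar> powr q \<le> \<bar>y n\<bar> powr p" for n
  proof (cases "y n = 0")
    case True
    then show ?thesis by (simp add: gen_duality_map_def)
  next
    case nz: False
    have "\<bar>gen_duality_map p y n\<bar> = \<bar>y n\<bar> powr (p - 1) / (1 + \<bar>y n\<bar>)"
      using nz by (simp add: gen_duality_map_def abs_mult abs_sgn_eq)
    also have "\<dots> \<le> \<bar>y n\<bar> powr (p - 1) / 1"
      by (intro divide_left_mono) auto
    finally have "\<bar>gen_duality_map p y n\<bar> powr q \<le> (\<bar>y n\<bar> powr (p - 1)) powr q"
      using conjugate_exponent[OF assms(1,2)] by (intro powr_mono2) auto
    then show ?thesis
      using conjugate_exponent[OF assms(1,2)] by (simp add: powr_powr)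
  qed
  have "summable (\<lambda>n. \<bar>y n\<bar> powr p)" using assms(3) by (simp add: lp_def)
  then show ?thesis
    unfolding lp_def mem_Collect_eq
    by (rule summable_comparison_test') (use bd in auto)
qed

lemma duality_sum_in_lp:
  fixes p q :: real
  assumes "1 < p" and "1 / p + 1 / q = 1" and "x \<in> lp p" and "y \<in> lp p"
  shows "(\<lambda>n. duality_map p x n + gen_duality_map p y n) \<in> lp q"
  using assms by (intro lp_add duality_map_in_lp gen_duality_map_in_lp conjugate_exponent(1))

text \<open>Limits are unique, so the relational derivatives determine their value.\<close>

lemma abs_le_lp_norm:
  assumes "0 < q" and "a \<in> lp q"
  shows "\<bar>a n\<bar> \<le> lp_norm q a"
proof -
  have "\<bar>a n\<bar> powr q \<le> (\<Sum>k. \<bar>a k\<bar> powr q)"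
    using sum_le_suminf[of "\<lambda>k. \<bar>a k\<bar> powr q" "{n}"] assms by (simp add: lp_def)
  then have "(\<bar>a n\<bar> powr q) powr (1 / q) \<le> lp_norm q a"
    unfolding lp_norm_def using assms(1) by (intro powr_mono2) auto
  then show ?thesis using assms(1) by (simp add: powr_powr)
qed

lemma tendsto_lp_unique:
  assumes "0 < q" and "\<F> \<noteq> bot" and "tendsto_lp q G z \<F>" and "tendsto_lp q G w \<F>"
  shows "z = w"
proof
  fix n
  have lim: "((\<lambda>t. G t n) \<longlongrightarrow> u n) \<F>" if u: "tendsto_lp q G u \<F>" for u
  proof -
    have minus: "(\<lambda>k. - u k) \<in> lp q" using u by (simp add: tendsto_lp_def lp_def)
    have "eventually (\<lambda>t. G t \<in> lp q) \<F>" using u by (simp add: tendsto_lp_def)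
    then have "eventually (\<lambda>t. norm (G t n - u n) \<le> lp_norm q (\<lambda>k. G t k - u k)) \<F>"
    proof eventually_elim
      case (elim t)
      show ?case
        using abs_le_lp_norm[OF assms(1) lp_add[OF assms(1) elim minus], of n] by simp
    qed
    moreover have "((\<lambda>t. lp_norm q (\<lambda>k. G t k - u k)) \<longlongrightarrow> 0) \<F>"
      using u by (simp add: tendsto_lp_def)
    ultimately have "((\<lambda>t. G t n - u n) \<longlongrightarrow> 0) \<F>"
      by (rule Lim_null_comparison)
    then show ?thesis by (simp add: LIM_zero_iff)
  qed
  show "z n = w n"
    using tendsto_unique[OF assms(2) lim[OF assms(3)] lim[OF assms(4)]] .
qed

end

theory Submission imports Defs begin

text \<open>
  Both halves rest on how the two duality maps behave along rays and on single coordinates.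

  The normalized map \<open>J\<close> is homogeneous, \<open>J (c x) = c J x\<close>
  (\<open>duality_map_scale\<close>). Along the ray through \<open>x\<close> its difference quotient at \<open>x\<close>
  is therefore the constant \<open>J x\<close>, and at the origin the quotient in direction \<open>v\<close> is the
  constant \<open>J v\<close>. These do not vanish, so no point is critical in the first variable.

  The generalized map acts coordinatewise through the odd function
  \<open>g s = \<bar>s\<bar>\<^sup>p\<^sup>-\<^sup>1 sgn s / (1 + \<bar>s\<bar>)\<close>. At the origin \<open>g\<close> is of order
  \<open>\<bar>s\<bar>\<^sup>p\<^sup>-\<^sup>1\<close>, and since \<open>(p - 1) q = p\<close> this pointwise bound sums up to
  a bound of order \<open>\<bar>t\<bar>\<^sup>p\<^sup>-\<^sup>2\<close> for the quotient in \<open>l\<^sub>q\<close>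
  (\<open>gen_duality_map_quotient_tendsto_theta\<close>). Away from the origin \<open>g\<close> is strictly
  increasing with nonzero derivative, so a point \<open>y \<noteq> \<theta>\<close> is not critical: the quotient
  in direction \<open>y\<close> itself has a nonzero limit in each coordinate where \<open>y\<close> is nonzero
  (\<open>gen_duality_map_ray_derivative\<close>).

  Finally, an extremum with respect to the cone bounds every coordinate on one side. But a fixed
  coordinate of either map is unbounded in both directions: at the multiples \<open>c e\<close> of a unit
  vector it is linear in \<open>c\<close> for \<open>J\<close>, and for the generalized map it is odd in
  \<open>c\<close> and at least \<open>c\<^sup>p\<^sup>-\<^sup>2 / 2\<close> for \<open>c \<ge> 1\<close>. Hence there are no
  extrema.
\<close>

section \<open>Sequence spaces\<close>

lemma lp_scale:
  assumes "x \<in> lp p"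
  shows "(\<lambda>n. c * x n) \<in> lp p"
  using assms by (simp add: lp_def abs_mult powr_mult summable_mult)

lemma lp_shift:
  assumes "0 < p" "x \<in> lp p" "v \<in> lp p"
  shows "(\<lambda>n. x n + t * v n) \<in> lp p"
  using lp_add[OF assms(1,2) lp_scale[OF assms(3)]] .

lemma theta_in_lp: "\<theta> \<in> lp p"
  by (simp add: lp_def theta_seq_def)

lemma single_in_lp: "(\<lambda>n. if n = k then c else 0) \<in> lp p"
proof -
  have "summable (\<lambda>n. if n = k then \<bar>c\<bar> powr p else 0)"
    by (rule sums_summable[OF sums_single])
  then show ?thesis
    by (simp add: lp_def if_distrib[of abs] if_distrib[of "\<lambda>s. s powr p"] cong: if_cong)
qed

lemma lp_norm_scale:
  assumes "0 < p" "x \<in> lp p"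
  shows "lp_norm p (\<lambda>n. c * x n) = \<bar>c\<bar> * lp_norm p x"
proof -
  have s: "summable (\<lambda>n. \<bar>x n\<bar> powr p)" using assms(2) by (simp add: lp_def)
  have "(\<Sum>n. \<bar>c * x n\<bar> powr p) = \<bar>c\<bar> powr p * (\<Sum>n. \<bar>x n\<bar> powr p)"
    using s by (simp add: abs_mult powr_mult suminf_mult)
  moreover have "(\<Sum>n. \<bar>x n\<bar> powr p) \<ge> 0" using s by (simp add: suminf_nonneg)
  ultimately show ?thesis
    using assms(1) by (simp add: lp_norm_def powr_mult powr_powr)
qed

lemma lp_norm_mono:
  assumes "0 < p" "b \<in> lp p" and le: "\<And>n. \<bar>a n\<bar> \<le> \<bar>b n\<bar>"
  shows "a \<in> lp p" and "lp_norm p a \<le> lp_norm p b"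
proof -
  have b: "summable (\<lambda>n. \<bar>b n\<bar> powr p)" using assms(2) by (simp add: lp_def)
  have pw: "\<bar>a n\<bar> powr p \<le> \<bar>b n\<bar> powr p" for n
    using le assms(1) by (intro powr_mono2) auto
  have a: "summable (\<lambda>n. \<bar>a n\<bar> powr p)"
    by (rule summable_comparison_test'[OF b]) (use pw in auto)
  then show "a \<in> lp p" by (simp add: lp_def)
  have "(\<Sum>n. \<bar>a n\<bar> powr p) \<le> (\<Sum>n. \<bar>b n\<bar> powr p)"
    using pw a b by (rule suminf_le)
  moreover have "0 \<le> (\<Sum>n. \<bar>a n\<bar> powr p)" using a by (simp add: suminf_nonneg)
  ultimately show "lp_norm p a \<le> lp_norm p b"
    unfolding lp_norm_def using assms(1) by (intro powr_mono2) auto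
qed

lemma tendsto_lp_theta_coordinate:
  assumes "0 < q" "tendsto_lp q G \<theta> \<F>"
  shows "((\<lambda>t. G t n) \<longlongrightarrow> 0) \<F>"
proof (rule Lim_null_comparison)
  have "eventually (\<lambda>t. G t \<in> lp q) \<F>"
    using assms(2) by (simp add: tendsto_lp_def)
  then show "eventually (\<lambda>t. norm (G t n) \<le> lp_norm q (G t)) \<F>"
    by eventually_elim (use abs_le_lp_norm[OF assms(1)] in simp)
  show "((\<lambda>t. lp_norm q (G t)) \<longlongrightarrow> 0) \<F>"
    using assms(2) by (simp add: tendsto_lp_def theta_seq_def)
qed

lemma no_cone_extremum_if_coordinate_unbounded:
  assumes above: "\<And>b. \<exists>x\<in>S. b < G x n" and below: "\<And>b. \<exists>x\<in>S. G x n < b"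
  shows "\<not> ((\<forall>x\<in>S. cone_le q z (G x)) \<or> (\<forall>x\<in>S. cone_le q (G x) z))"
proof -
  have le: "z1 n \<le> z2 n" if "cone_le q z1 z2" for z1 z2
    using that by (auto simp: cone_le_def pos_cone_def)
  obtain a where "a \<in> S" "z n < G a n" using above by blast
  moreover obtain b where "b \<in> S" "G b n < z n" using below by blast
  ultimately show ?thesis using le by fastforce
qed

section \<open>The normalized duality map\<close>

text \<open>The numerator of \<open>J\<close> is homogeneous of degree \<open>p - 1\<close> and its denominator of
  degree \<open>p - 2\<close>, so a single factor \<open>c\<close> remains. The sign of \<open>c\<close> comes from the
  signum.\<close>

lemma duality_map_scale:
  assumes "0 < p" "x \<in> lp p"
  shows "duality_map p (\<lambda>k. c * x k) n = c * duality_map p x n"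
proof (cases "c = 0 \<or> x = \<theta>")
  case True
  then show ?thesis by (auto simp: duality_map_def theta_seq_def)
next
  case False
  then have c: "c \<noteq> 0" and x: "x \<noteq> \<theta>" by auto
  have cx: "(\<lambda>k. c * x k) \<noteq> \<theta>"
    using c x by (auto simp: theta_seq_def fun_eq_iff)
  have N: "lp_norm p x \<ge> 0" by (simp add: lp_norm_def)
  have factor: "\<bar>c\<bar> powr (p - 1) * sgn c = c * \<bar>c\<bar> powr (p - 2)"
    using c powr_add[of "\<bar>c\<bar>" "p - 2" 1] by (simp add: sgn_if)
  have "duality_map p (\<lambda>k. c * x k) n =
      (\<bar>c\<bar> powr (p - 1) * sgn c) * (\<bar>x n\<bar> powr (p - 1) * sgn (x n)) /
      (\<bar>c\<bar> powr (p - 2) * lp_norm p x powr (p - 2))"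
    using cx N
    by (simp add: duality_map_def lp_norm_scale[OF assms] abs_mult sgn_mult powr_mult mult_ac)
  also have "\<dots> = c * duality_map p x n"
    using c x unfolding factor by (simp add: duality_map_def)
  finally show ?thesis .
qed

lemma duality_map_nonzero:
  assumes "0 < p" "x \<in> lp p" "x n \<noteq> 0"
  shows "duality_map p x n \<noteq> 0"
proof -
  have "x \<noteq> \<theta>" using assms(3) by (auto simp: theta_seq_def)
  moreover have "lp_norm p x > 0" using abs_le_lp_norm[OF assms(1,2), of n] assms(3) by linarith
  ultimately show ?thesis using assms(3) by (simp add: duality_map_def sgn_if)
qed

lemma duality_map_coordinate_surj:
  assumes "0 < p"
  shows "\<exists>x\<in>lp p. duality_map p x n = b"
proof -
  define e :: "nat \<Rightarrow> real" where "e = (\<lambda>k. if k = n then 1 else 0)"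
  have e: "e \<in> lp p" unfolding e_def by (rule single_in_lp)
  define d where "d = duality_map p e n"
  have "d \<noteq> 0" unfolding d_def using assms e by (rule duality_map_nonzero) (simp add: e_def)
  then have "duality_map p (\<lambda>k. (b / d) * e k) n = b"
    by (subst duality_map_scale[OF assms e]) (simp add: d_def)
  then show ?thesis using lp_scale[OF e] by blast
qed

text \<open>The two cases are one idea: on a ray through the origin the quotient is constant. At a
  nonzero point the direction has to be radial to use it, while at the origin every direction
  is.\<close>

lemma duality_map_no_critical_point:
  assumes "0 < p" "0 < q" "x \<in> lp p"
  shows "\<exists>v\<in>lp p - {\<theta>}.
    \<not> tendsto_lp q (\<lambda>t n. (duality_map p (\<lambda>k. x k + t * v k) n - duality_map p x n) / t) \<theta> (at 0)"
proof -
  define v where "v = (if x = \<theta> then (\<lambda>n. if n = 0 then 1 else 0) else x)"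
  have v: "v \<in> lp p" unfolding v_def using assms(3) single_in_lp by auto
  have "v \<noteq> \<theta>" unfolding v_def by (auto simp: theta_seq_def dest: fun_cong[of _ _ 0])
  then obtain n where n: "v n \<noteq> 0" by (auto simp: theta_seq_def)
  have quot: "(duality_map p (\<lambda>k. x k + t * v k) n - duality_map p x n) / t = duality_map p v n"
    if "t \<noteq> 0" for t
  proof (cases "x = \<theta>")
    case True
    then have "(\<lambda>k. x k + t * v k) = (\<lambda>k. t * v k)" by (simp add: theta_seq_def)
    then show ?thesis
      using True that by (simp add: duality_map_scale[OF assms(1) v])
        (simp add: duality_map_def theta_seq_def)
  next
    case False
    then have "x = v" and ray: "(\<lambda>k. x k + t * v k) = (\<lambda>k. (1 + t) * v k)"
      by (auto simp: v_def algebra_simps)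
    then show ?thesis
      using that unfolding ray duality_map_scale[OF assms(1) v]
      by (simp add: distrib_right)
  qed
  show ?thesis
  proof (intro bexI notI)
    assume "tendsto_lp q
      (\<lambda>t n. (duality_map p (\<lambda>k. x k + t * v k) n - duality_map p x n) / t) \<theta> (at 0)"
    from tendsto_lp_theta_coordinate[OF assms(2) this, of n]
    have "((\<lambda>t::real. duality_map p v n) \<longlongrightarrow> 0) (at 0)"
      by (rule Lim_transform_eventually) (auto simp: eventually_at_filter quot)
    then have "duality_map p v n = 0" by (simp add: tendsto_const_iff)
    then show False using duality_map_nonzero[OF assms(1) v n] by simp
  qed (use v \<open>v \<noteq> \<theta>\<close> in auto)
qed

section \<open>The generalized duality map\<close>

text \<open>For \<open>s \<ge> 1\<close> the denominator is at most \<open>2 s\<close>, so a coordinate \<open>s\<close> has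
  image at least \<open>s\<^sup>p\<^sup>-\<^sup>2 / 2\<close>, which grows without bound. Oddness gives the other
  direction.\<close>

lemma gen_duality_map_coordinate_unbounded:
  assumes "2 < p"
  shows "\<exists>y\<in>lp p. b < gen_duality_map p y n" and "\<exists>y\<in>lp p. gen_duality_map p y n < b"
proof -
  have "\<exists>y\<in>lp p. \<bar>b\<bar> < gen_duality_map p y n"
  proof
    \<comment> \<open>The solution of \<open>c\<^sup>p\<^sup>-\<^sup>2 / 2 = \<bar>b\<bar> + 1\<close>.\<close>
    define c where "c = (2 * (\<bar>b\<bar> + 1)) powr (1 / (p - 2))"
    have c: "c \<ge> 1" unfolding c_def using assms by (intro ge_one_powr_ge_zero) auto
    show "(\<lambda>k. if k = n then c else 0) \<in> lp p" by (rule single_in_lp)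
    have "c powr (p - 2) = 2 * (\<bar>b\<bar> + 1)"
      using assms by (simp add: c_def powr_powr)
    then have "c powr (p - 1) = 2 * (\<bar>b\<bar> + 1) * c"
      using c powr_add[of c "p - 2" 1] by simp
    also have "\<dots> \<ge> (\<bar>b\<bar> + 1) * (1 + c)"
      using mult_left_mono[of "1 + c" "2 * c" "\<bar>b\<bar> + 1"] c by (simp add: mult_ac)
    finally have "\<bar>b\<bar> + 1 \<le> c powr (p - 1) / (1 + c)" using c by (simp add: pos_le_divide_eq)
    then show "\<bar>b\<bar> < gen_duality_map p (\<lambda>k. if k = n then c else 0) n"
      using c by (simp add: gen_duality_map_def)
  qed
  then obtain y where y: "y \<in> lp p" "\<bar>b\<bar> < gen_duality_map p y n" by blast
  then show "\<exists>y\<in>lp p. b < gen_duality_map p y n" by force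
  have "gen_duality_map p (\<lambda>k. -1 * y k) n < b"
    using y(2) by (simp add: gen_duality_map_def sgn_minus)
  then show "\<exists>y\<in>lp p. gen_duality_map p y n < b" using lp_scale[OF y(1)] by blast
qed

text \<open>Each coordinate of the quotient is at most \<open>\<bar>t\<bar>\<^sup>p\<^sup>-\<^sup>2 \<bar>v n\<bar>\<^sup>p\<^sup>-\<^sup>1\<close>,
  and \<open>\<bar>v\<bar>\<^sup>p\<^sup>-\<^sup>1\<close> lies in \<open>l\<^sub>q\<close> because \<open>(p - 1) q = p\<close>. The exponent
  \<open>p - 2\<close> is positive, so the bound vanishes with \<open>t\<close>.\<close>

lemma gen_duality_map_quotient_tendsto_theta:
  assumes p: "2 < p" and pq: "1 / p + 1 / q = 1" and v: "v \<in> lp p"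
  shows "tendsto_lp q (\<lambda>t n. gen_duality_map p (\<lambda>k. t * v k) n / t) \<theta> (at 0)"
proof -
  have q: "0 < q" "(p - 1) * q = p" using conjugate_exponent[of p q] p pq by auto
  define w where "w = (\<lambda>n. \<bar>v n\<bar> powr (p - 1))"
  have w: "w \<in> lp q" using v q by (simp add: w_def lp_def powr_powr)
  define G where "G = (\<lambda>t n. gen_duality_map p (\<lambda>k. t * v k) n / t)"
  have bd: "\<bar>G t n\<bar> \<le> \<bar>\<bar>t\<bar> powr (p - 2) * w n\<bar>" for t n
  proof (cases "t = 0 \<or> v n = 0")
    case True
    then show ?thesis by (auto simp: G_def gen_duality_map_def)
  next
    case False
    have "\<bar>t\<bar> powr (p - 1) = \<bar>t\<bar> powr (p - 2) * \<bar>t\<bar>"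
      using powr_add[of "\<bar>t\<bar>" "p - 2" 1] by simp
    then have "\<bar>G t n\<bar> = \<bar>t\<bar> powr (p - 2) * w n / (1 + \<bar>t * v n\<bar>)"
      using False
      by (simp add: G_def gen_duality_map_def w_def abs_mult powr_mult abs_sgn_eq)
    also have "\<dots> \<le> \<bar>t\<bar> powr (p - 2) * w n / 1"
      by (intro divide_left_mono) (auto simp: w_def)
    finally show ?thesis by (simp add: w_def)
  qed
  note dom = lp_norm_mono[OF q(1) lp_scale[OF w], OF bd]
  have "((\<lambda>t. lp_norm q (G t)) \<longlongrightarrow> 0) (at 0)"
  proof (rule Lim_null_comparison)
    show "eventually (\<lambda>t. norm (lp_norm q (G t)) \<le> \<bar>t\<bar> powr (p - 2) * lp_norm q w) (at 0)"
    proof (rule always_eventually, rule allI)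
      fix t
      have "0 \<le> lp_norm q (G t)" by (simp add: lp_norm_def)
      then show "norm (lp_norm q (G t)) \<le> \<bar>t\<bar> powr (p - 2) * lp_norm q w"
        using dom(2)[of t] lp_norm_scale[OF q(1) w, of "\<bar>t\<bar> powr (p - 2)"] by simp
    qed
    have "((\<lambda>t::real. \<bar>t\<bar> powr (p - 2)) \<longlongrightarrow> 0) (at 0)"
      using p by (intro tendsto_zero_powrI) (auto intro!: tendsto_eq_intros)
    then show "((\<lambda>t. \<bar>t\<bar> powr (p - 2) * lp_norm q w) \<longlongrightarrow> 0) (at 0)"
      by (rule tendsto_mult_left_zero)
  qed
  then show ?thesis
    using dom(1) theta_in_lp by (simp add: tendsto_lp_def G_def theta_seq_def)
qed

text \<open>Moving along the ray through \<open>y\<close> keeps the sign of each coordinate for small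
  \<open>t\<close>, so the signum is a constant factor and positive and negative coordinates need no
  distinction.\<close>

lemma gen_duality_map_ray_derivative:
  assumes p: "2 < p" and y: "y n \<noteq> 0"
  obtains D where "D \<noteq> 0"
    "((\<lambda>t. (gen_duality_map p (\<lambda>k. y k + t * y k) n - gen_duality_map p y n) / t) \<longlongrightarrow> D) (at 0)"
proof -
  define a where "a = \<bar>y n\<bar>"
  define c where "c = a powr (p - 1) * sgn (y n)"
  define h where "h = (\<lambda>t. c * ((1 + t) powr (p - 1) / (1 + (1 + t) * a)))"
  define D where "D = c * (((p - 1) * (1 + a) - a) / ((1 + a) * (1 + a)))"
  have a: "a > 0" using y by (simp add: a_def)
  have c: "c \<noteq> 0" using a y by (simp add: c_def sgn_if)
  have "(p - 1) * (1 + a) - a = (p - 2) * (1 + a) + 1" by (simp add: algebra_simps)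
  also have "\<dots> > 0" using a p by (simp add: add_pos_pos)
  finally have D: "D \<noteq> 0" using a c by (simp add: D_def)
  have h: "gen_duality_map p (\<lambda>k. y k + t * y k) n = h t" if "-1 < t" for t
  proof -
    have e: "y n + t * y n = (1 + t) * y n" by (simp add: algebra_simps)
    show ?thesis
      using that unfolding gen_duality_map_def e
      by (simp add: h_def c_def a_def abs_mult sgn_mult powr_mult mult_ac)
  qed
  have "(h has_real_derivative D) (at 0)"
    unfolding h_def D_def using a by (auto intro!: derivative_eq_intros simp: field_simps)
  then have "((\<lambda>t. (h t - h 0) / t) \<longlongrightarrow> D) (at 0)"
    by (simp add: DERIV_def)
  moreover have "eventually (\<lambda>t. (h t - h 0) / t =
      (gen_duality_map p (\<lambda>k. y k + t * y k) n - gen_duality_map p y n) / t) (at 0)"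
  proof -
    have "eventually (\<lambda>t::real. -1 < t) (at 0)"
      by (rule order_tendstoD(1)[OF tendsto_ident_at]) simp
    then show ?thesis by eventually_elim (use h h[of 0] in simp)
  qed
  ultimately have "((\<lambda>t. (gen_duality_map p (\<lambda>k. y k + t * y k) n - gen_duality_map p y n) / t)
      \<longlongrightarrow> D) (at 0)"
    by (rule Lim_transform_eventually)
  with D show thesis by (rule that)
qed

section \<open>Critical and extremal points of the sum\<close>

theorem theorem6p2:
  fixes p q :: real
    and F :: "(nat \<Rightarrow> real) \<times> (nat \<Rightarrow> real) \<Rightarrow> nat \<Rightarrow> real"
  assumes "3 < p"
    and "1 / p + 1 / q = 1"
    and "\<And>x y. x \<in> lp p \<Longrightarrow> y \<in> lp p \<Longrightarrow>
           F (x, y) = (\<lambda>n. duality_map p x n + gen_duality_map p y n)"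
  shows "(crit1 p q F = {} \<and> extr1 p q F = {}) \<and>
         (crit2 p q F = lp p \<times> {\<theta>} \<and> extr2 p q F = {})"
proof -
  have p: "0 < p" "2 < p" using assms(1) by auto
  have q: "0 < q" using conjugate_exponent(1)[of p q] assms by auto
  note F = assms(3)
  \<comment> \<open>Each partial quotient only sees its own summand of \<open>F\<close>.\<close>
  have partial1: "has_partial1 q F x y v w \<longleftrightarrow>
      tendsto_lp q (\<lambda>t n. (duality_map p (\<lambda>k. x k + t * v k) n - duality_map p x n) / t) w (at 0)"
    if "x \<in> lp p" "y \<in> lp p" "v \<in> lp p" for x y v w
    using that by (simp add: has_partial1_def F lp_shift[OF p(1)])
  have partial2: "has_partial2 q F x y v w \<longleftrightarrow>
      tendsto_lp q
        (\<lambda>t n. (gen_duality_map p (\<lambda>k. y k + t * v k) n - gen_duality_map p y n) / t) w (at 0)"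
    if "x \<in> lp p" "y \<in> lp p" "v \<in> lp p" for x y v w
    using that by (simp add: has_partial2_def F lp_shift[OF p(1)])
  have crit1: "crit1 p q F = {}"
    using duality_map_no_critical_point[OF p(1) q] partial1 by (fastforce simp: crit1_def)
  have "(x, y) \<notin> extr1 p q F" for x y
  proof
    assume "(x, y) \<in> extr1 p q F"
    then have y: "y \<in> lp p"
      and ex: "(\<forall>x'\<in>lp p. cone_le q (F (x, y)) (F (x', y))) \<or>
        (\<forall>x'\<in>lp p. cone_le q (F (x', y)) (F (x, y)))"
      by (auto simp: extr1_def)
    have hit: "\<exists>x'\<in>lp p. F (x', y) 0 = b" for b
      using duality_map_coordinate_surj[OF p(1), of 0 "b - gen_duality_map p y 0"] F[OF _ y] by force
    have "\<exists>x'\<in>lp p. b < F (x', y) 0" "\<exists>x'\<in>lp p. F (x', y) 0 < b" for b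
      using hit[of "b + 1"] hit[of "b - 1"] by force+
    from no_cone_extremum_if_coordinate_unbounded[of "lp p" "\<lambda>x'. F (x', y)", OF this] ex
    show False by blast
  qed
  then have extr1: "extr1 p q F = {}" by auto
  have "y = \<theta>" if "(x, y) \<in> crit2 p q F" for x y
  proof (rule ccontr)
    assume ne: "y \<noteq> \<theta>"
    then obtain n where n: "y n \<noteq> 0" by (auto simp: theta_seq_def)
    have "x \<in> lp p" "y \<in> lp p" "has_partial2 q F x y y \<theta>"
      using that ne by (auto simp: crit2_def)
    then have "tendsto_lp q
        (\<lambda>t n. (gen_duality_map p (\<lambda>k. y k + t * y k) n - gen_duality_map p y n) / t) \<theta> (at 0)"
      using partial2 by blast
    note lim = tendsto_lp_theta_coordinate[OF q this, of n]
    obtain D where D: "D \<noteq> 0"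
      "((\<lambda>t. (gen_duality_map p (\<lambda>k. y k + t * y k) n - gen_duality_map p y n) / t) \<longlongrightarrow> D) (at 0)"
      using gen_duality_map_ray_derivative[of p y n, OF p(2) n] .
    show False using D(1) tendsto_unique[OF at_neq_bot D(2) lim] by contradiction
  qed
  moreover have "(x, \<theta>) \<in> crit2 p q F" if "x \<in> lp p" for x
  proof -
    have "has_partial2 q F x \<theta> v \<theta>" if "v \<in> lp p" for v
      using gen_duality_map_quotient_tendsto_theta[OF p(2) assms(2) that]
      by (subst partial2[OF \<open>x \<in> lp p\<close> theta_in_lp that])
        (simp add: theta_seq_def gen_duality_map_def)
    then show ?thesis using that theta_in_lp by (simp add: crit2_def)
  qed
  moreover have "crit2 p q F \<subseteq> lp p \<times> lp p" by (auto simp: crit2_def)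
  ultimately have crit2: "crit2 p q F = lp p \<times> {\<theta>}" by blast
  have "(x, y) \<notin> extr2 p q F" for x y
  proof
    assume "(x, y) \<in> extr2 p q F"
    then have x: "x \<in> lp p"
      and ex: "(\<forall>y'\<in>lp p. cone_le q (F (x, y)) (F (x, y'))) \<or>
        (\<forall>y'\<in>lp p. cone_le q (F (x, y')) (F (x, y)))"
      by (auto simp: extr2_def)
    have "\<exists>y'\<in>lp p. b < F (x, y') 0" "\<exists>y'\<in>lp p. F (x, y') 0 < b" for b
      using gen_duality_map_coordinate_unbounded[where b = "b - duality_map p x 0" and n = 0, OF p(2)] F[OF x]
      by (force simp: algebra_simps)+
    from no_cone_extremum_if_coordinate_unbounded[of "lp p" "\<lambda>y'. F (x, y')", OF this] ex
    show False by blast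
  qed
  then have extr2: "extr2 p q F = {}" by auto
  show ?thesis using crit1 extr1 crit2 extr2 by simp
qed

end
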